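(* For each $n\ge 2$ and each $k\ge 1$ there exists a $1$-PDDS$[P_k]$ in $\Lambda_n$.
   Context: $\Lambda_n$ is the infinite graph with vertex set $\mathbb{Z}^n$ in which two vertices are adjacent iff their Euclidean distance is $1$; $d$ denotes graph distance. For $S$ a set of vertices, $[S]$ is the induced subgraph and $d(v,C)=\min\{d(v,w):w\in C\}$. For $t\ge1$, $S$ is a $t$-perfect distance-dominating set ($t$-PDDS) if for each vertex $v$ there is a unique component $C_v$ of $[S]$ with $d(v,C_v)\le t$, and there is in $C_v$ a unique vertex $w$ with $d(v,w)=d(v,C_v)$. A $t$-PDDS$[H]$ is a $t$-PDDS all of whose components are isomorphic to the fixed finite graph $H$. $P_k$ is the path on $k$ vertices. *)

theory Defs
  imports "Graph_Theory.Graph_Theory" "HOL-Analysis.L2_Norm" "HOL-Library.FuncSet"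
begin

text \<open>
  Undirected graphs are symmetric digraphs whose arcs are ordered pairs: an edge between \<open>x\<close> and
  \<open>y\<close> is the pair of arcs \<open>(x, y)\<close> and \<open>(y, x)\<close>.
\<close>

text \<open>
  A point of \<open>\<int>\<^sup>n\<close> is an integer function on \<open>{..<n}\<close>, made \<open>undefined\<close> outside \<open>{..<n}\<close> by
  \<open>\<rightarrow>\<^sub>E\<close>.
\<close>

definition lattice_points :: "nat \<Rightarrow> (nat \<Rightarrow> int) set" where
  "lattice_points n = {..<n} \<rightarrow>\<^sub>E (UNIV :: int set)"

definition euclid_dist :: "nat \<Rightarrow> (nat \<Rightarrow> int) \<Rightarrow> (nat \<Rightarrow> int) \<Rightarrow> real" where
  "euclid_dist n x y = L2_set (\<lambda>i. real_of_int (x i) - real_of_int (y i)) {..<n}"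

definition lattice_graph ::
    "nat \<Rightarrow> (nat \<Rightarrow> int, (nat \<Rightarrow> int) \<times> (nat \<Rightarrow> int)) pre_digraph" where
  "lattice_graph n = with_proj
     \<lparr> pverts = lattice_points n,
       parcs = {(x, y). x \<in> lattice_points n \<and> y \<in> lattice_points n \<and> euclid_dist n x y = 1} \<rparr>"

definition path_graph :: "nat \<Rightarrow> (nat, nat \<times> nat) pre_digraph" where
  "path_graph k = with_proj
     \<lparr> pverts = {..<k}, parcs = {(i, j). i < k \<and> j < k \<and> (j = Suc i \<or> i = Suc j)} \<rparr>"

lemma sym_digraph_lattice_graph: "sym_digraph (lattice_graph n)"
  by unfold_locales
    (auto simp: lattice_graph_def with_proj_def symmetric_def arcs_ends_def arc_to_ends_def
      euclid_dist_def L2_set_def power2_commute intro!: symI)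

lemma graph_path_graph: "graph (path_graph k)"
proof unfold_locales
  have "{(i, j). i < k \<and> j < k \<and> (j = Suc i \<or> i = Suc j)} \<subseteq> {..<k} \<times> {..<k}"
    by auto
  then show "finite (arcs (path_graph k))"
    by (simp add: path_graph_def with_proj_def finite_subset)
qed (auto simp: path_graph_def with_proj_def symmetric_def arcs_ends_def arc_to_ends_def
    intro!: symI)

definition components :: "('a, 'b) pre_digraph \<Rightarrow> ('a, 'b) pre_digraph set" where
  "components G = {C. pre_digraph.max_subgraph G Digraph_Component.connected C}"

text \<open>
  The distance is \<open>\<infinity>\<close> between vertices not joined by a walk. Finite distances are natural numbers,
  so the infimum over a component is a minimum.
\<close>

definition graph_dist :: "('a, 'b) pre_digraph \<Rightarrow> 'a \<Rightarrow> 'a \<Rightarrow> ereal" where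
  "graph_dist G v w = wf_digraph.\<mu> G (\<lambda>_. 1) v w"

definition set_dist :: "('a, 'b) pre_digraph \<Rightarrow> 'a \<Rightarrow> 'a set \<Rightarrow> ereal" where
  "set_dist G v W = (INF w\<in>W. graph_dist G v w)"

definition PDDS :: "('a, 'b) pre_digraph \<Rightarrow> nat \<Rightarrow> 'a set \<Rightarrow> bool" where
  "PDDS G t S \<longleftrightarrow> S \<subseteq> verts G \<and>
     (\<forall>v\<in>verts G. \<exists>C.
        (\<forall>D. D \<in> components (G \<restriction> S) \<and> set_dist G v (verts D) \<le> ereal (real t) \<longleftrightarrow> D = C) \<and>
        (\<exists>!w. w \<in> verts C \<and> graph_dist G v w = set_dist G v (verts C)))"

definition PDDS_of ::
    "('a, 'b) pre_digraph \<Rightarrow> nat \<Rightarrow> ('c, 'd) pre_digraph \<Rightarrow> 'a set \<Rightarrow> bool" where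
  "PDDS_of G t H S \<longleftrightarrow> PDDS G t S \<and> (\<forall>C\<in>components (G \<restriction> S). digraph_iso C H)"

end

theory Submission
  imports Defs
begin

text \<open>
  Put \<open>m = (2n - 1)k + 2\<close>, the size of the closed neighbourhood of a straight path with \<open>k\<close>
  vertices, and colour \<open>x \<in> \<int>\<^sup>n\<close> by \<open>\<phi> x = (\<Sum>i<n. (i k + 1) x\<^sub>i) mod m\<close>. Let \<open>S\<close> consist of the
  points of colour less than \<open>k\<close>. A step along axis \<open>i\<close> changes the colour by \<open>\<plusminus>(i k + 1)\<close>. The
  intervals \<open>[0, k) \<plusminus> (i k + 1)\<close> with \<open>0 < i < n\<close>, together with \<open>[-1, k]\<close>, partition the residues
  modulo \<open>m\<close>. Hence two points of \<open>S\<close> are adjacent only along axis \<open>0\<close>, so that the components of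
  \<open>S\<close> are straight paths, and every point outside \<open>S\<close> has exactly one neighbour in \<open>S\<close>.
\<close>

section \<open>Components and distances\<close>

text \<open>Connectedness is strong connectedness of the symmetric closure, and the value of
  \<open>f\<close> survives each arc traversed in either direction.\<close>

lemma connected_imp_eq_label:
  assumes "Digraph_Component.connected H"
    and "\<And>a. a \<in> arcs H \<Longrightarrow> f (tail H a) = f (head H a)"
    and "u \<in> verts H" "v \<in> verts H"
  shows "f u = f v"
proof -
  have "u \<rightarrow>\<^sup>*\<^bsub>with_proj (mk_symmetric H)\<^esub> v"
    using assms(1,3,4) unfolding Digraph_Component.connected_def strongly_connected_def by auto
  then have "(u, v) \<in> (parcs (mk_symmetric H))\<^sup>*"
    using reachable_rtranclI by fastforce
  then show ?thesis
    by induction (use assms(2) in \<open>auto simp: parcs_mk_symmetric\<close>)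
qed

text \<open>A label constant along arcs keeps every connected subgraph inside one label class, so a
  class that is itself connected is maximal. Components are thus identified without tracing
  walks.\<close>

lemma (in wf_digraph) components_eq_label_classes:
  fixes f :: "'a \<Rightarrow> 'c"
  defines "B \<equiv> \<lambda>v. G \<restriction> {u \<in> verts G. f u = f v}"
  assumes arcs: "\<And>a. a \<in> arcs G \<Longrightarrow> f (tail G a) = f (head G a)"
    and conn: "\<And>v. v \<in> verts G \<Longrightarrow> Digraph_Component.connected (B v)"
  shows "components G = B ` verts G"
proof -
  have sub_B: "subgraph (B v) G" for v
    unfolding B_def by (intro induced_imp_subgraph induced_induce) auto
  have sub: "subgraph H (B v)"
    if H: "subgraph H G" "Digraph_Component.connected H" "v \<in> verts H" for H v
  proof -
    have *: "tail H = tail G" "head H = head G" "wf_digraph H" "arcs H \<subseteq> arcs G"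
      "verts H \<subseteq> verts G"
      using H(1) by (auto simp: subgraph_def compatible_def)
    interpret H: wf_digraph H by fact
    have f: "f u = f v" if "u \<in> verts H" for u
      using H that arcs * by (intro connected_imp_eq_label[of H f u v]) auto
    have "arcs H \<subseteq> arcs (B v)"
    proof
      fix a assume "a \<in> arcs H"
      then show "a \<in> arcs (B v)"
        using H.tail_in_verts[of a] H.head_in_verts[of a] f * by (auto simp: B_def)
    qed
    then show ?thesis
      using * f sub_B[of v] by (auto simp: subgraph_def compatible_def B_def)
  qed
  show ?thesis
  proof (intro equalityI subsetI)
    fix C assume "C \<in> components G"
    then have C: "subgraph C G" "Digraph_Component.connected C"
      "\<And>H. H \<noteq> C \<Longrightarrow> subgraph C H \<Longrightarrow> subgraph H G \<Longrightarrow> \<not> Digraph_Component.connected H"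
      by (auto simp: components_def max_subgraph_def)
    then obtain v where v: "v \<in> verts C"
      by (auto simp: Digraph_Component.connected_def strongly_connected_def)
    then have "v \<in> verts G" using C(1) by auto
    moreover have "B v = C"
      using C(3)[of "B v"] sub[OF C(1,2) v] sub_B conn \<open>v \<in> verts G\<close> by auto
    ultimately show "C \<in> B ` verts G" by auto
  next
    fix C assume "C \<in> B ` verts G"
    then obtain v where v: "v \<in> verts G" "C = B v" by auto
    \<comment> \<open>A connected \<open>H\<close> above \<open>C\<close> still contains
      \<open>v\<close>, so \<open>sub\<close> puts it back inside \<open>C\<close>.\<close>
    have "H = C" if H: "subgraph C H" "subgraph H G" "Digraph_Component.connected H" for H
    proof -
      have "v \<in> verts H" using subgraph_imp_subverts[OF H(1)] v by (auto simp: B_def)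
      then have "subgraph H C" using sub H v by auto
      then show ?thesis
        using H(1) by (auto simp: subgraph_def compatible_def intro: pre_digraph.equality)
    qed
    then show "C \<in> components G"
      using v sub_B conn by (auto simp: components_def max_subgraph_def)
  qed
qed

section \<open>Distances 0, 1 and at least 2\<close>

lemma (in wf_digraph) graph_dist_nonneg: "0 \<le> graph_dist G v w"
  unfolding graph_dist_def \<mu>_def
  by (intro INF_greatest) (auto intro!: pos_cost_pos_awalk_cost)

lemma (in wf_digraph) graph_dist_self: "v \<in> verts G \<Longrightarrow> graph_dist G v v = 0"
  using min_cost_le_walk_cost[of v "[]" v "\<lambda>_. 1"] graph_dist_nonneg[of v v]
  by (simp add: awalk_Nil_iff graph_dist_def flip: zero_ereal_def)

lemma (in wf_digraph) graph_dist_ge_1: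
  assumes "v \<noteq> w"
  shows "1 \<le> graph_dist G v w"
  unfolding graph_dist_def \<mu>_def
proof (intro INF_greatest)
  fix p assume p: "p \<in> {p. awalk v p w}"
  with assms obtain e q where [simp]: "p = e # q"
    by (cases p) (auto simp: awalk_Nil_iff)
  have "0 \<le> awalk_cost (\<lambda>_. 1) q"
    using p by (auto simp: awalk_Cons_iff intro!: pos_cost_pos_awalk_cost)
  then show "1 \<le> ereal (awalk_cost (\<lambda>_. 1) p)" by simp
qed

lemma (in wf_digraph) graph_dist_adj:
  assumes "v \<rightarrow>\<^bsub>G\<^esub> w" "v \<noteq> w"
  shows "graph_dist G v w = 1"
proof -
  obtain e where "e \<in> arcs G" "tail G e = v" "head G e = w"
    using assms(1) by (auto simp: arcs_ends_def arc_to_ends_def)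
  then have "awalk v [e] w" by (auto simp: awalk_Cons_iff awalk_Nil_iff)
  then have "graph_dist G v w \<le> 1"
    using min_cost_le_walk_cost[of v "[e]" w "\<lambda>_. 1"] by (simp add: graph_dist_def one_ereal_def)
  with graph_dist_ge_1[OF assms(2)] show ?thesis by simp
qed

text \<open>Such a walk has a first and a second arc, and the rest costs at least 0. If there is no
  walk, the infimum over the empty set is infinite.\<close>

lemma (in wf_digraph) graph_dist_ge_2:
  assumes "v \<noteq> w" "\<not> v \<rightarrow>\<^bsub>G\<^esub> w"
  shows "2 \<le> graph_dist G v w"
  unfolding graph_dist_def \<mu>_def
proof (intro INF_greatest)
  fix p assume p: "p \<in> {p. awalk v p w}"
  with assms(1) obtain e q where [simp]: "p = e # q"
    by (cases p) (auto simp: awalk_Nil_iff)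
  obtain e' q' where [simp]: "q = e' # q'"
    using p assms(2)
    by (cases q) (auto simp: awalk_Nil_iff awalk_Cons_iff dest: in_arcs_imp_in_arcs_ends)
  have "0 \<le> awalk_cost (\<lambda>_. 1) q'"
    using p by (auto simp: awalk_Cons_iff intro!: pos_cost_pos_awalk_cost)
  then show "2 \<le> ereal (awalk_cost (\<lambda>_. 1) p)" by simp
qed

lemma (in wf_digraph) set_dist_le_1_imp:
  assumes "set_dist G v W \<le> 1"
  shows "v \<in> W \<or> (\<exists>w\<in>W. v \<rightarrow>\<^bsub>G\<^esub> w)"
proof (rule ccontr)
  assume "\<not> ?thesis"
  then have "2 \<le> set_dist G v W"
    unfolding set_dist_def by (intro INF_greatest graph_dist_ge_2) auto
  with assms have "(2::ereal) \<le> 1" by (rule order_trans[rotated])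
  then show False by simp
qed

text \<open>This reduces domination at distance 1 to local conditions. Since \<open>H\<close> is
  connected, so are the label classes, which are therefore the components. Both uniqueness clauses
  come from a single vertex of \<open>S\<close> nearest to \<open>v\<close>.\<close>

lemma (in wf_digraph) PDDS_of_1_if_label_classes:
  fixes f :: "'a \<Rightarrow> 'c" and H :: "('d, 'e) pre_digraph"
  assumes S: "S \<subseteq> verts G"
    and H: "wf_digraph H" "Digraph_Component.connected H"
    and arcs: "\<And>v w. v \<in> S \<Longrightarrow> w \<in> S \<Longrightarrow> v \<rightarrow>\<^bsub>G\<^esub> w \<Longrightarrow> f v = f w"
    and iso: "\<And>v. v \<in> S \<Longrightarrow> digraph_iso H (G \<restriction> {u \<in> S. f u = f v})"
    and ex1: "\<And>v. v \<in> verts G \<Longrightarrow> v \<notin> S \<Longrightarrow> \<exists>!w. w \<in> S \<and> v \<rightarrow>\<^bsub>G\<^esub> w"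
  shows "PDDS_of G 1 H S"
proof -
  define B where "B v = G \<restriction> {u \<in> S. f u = f v}" for v
  have verts_B: "verts (B v) = {u \<in> S. f u = f v}" for v
    by (simp add: B_def)
  \<comment> \<open>Inducing on \<open>S\<close> and then on a class equals inducing once;
    \<open>components_eq_label_classes\<close> speaks of the two-stage form.\<close>
  have B_eq: "B = (\<lambda>v. (G \<restriction> S) \<restriction> {u \<in> verts (G \<restriction> S). f u = f v})"
    unfolding B_def by (intro ext pre_digraph.equality) auto
  have B_cong: "B v = B w" if "f v = f w" for v w
    using that by (simp add: B_def)
  interpret GS: wf_digraph "G \<restriction> S" ..
  have conn: "Digraph_Component.connected (B v)" if v: "v \<in> S" for v
    using iso[OF v] H(2) unfolding digraph_iso_def B_def
    by (auto intro: wf_digraph.connectedI_app_iso[OF H(1)])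
  have "components (G \<restriction> S) = (\<lambda>v. (G \<restriction> S) \<restriction> {u \<in> verts (G \<restriction> S). f u = f v}) ` verts (G \<restriction> S)"
  proof (rule GS.components_eq_label_classes)
    fix a assume "a \<in> arcs (G \<restriction> S)"
    then show "f (tail (G \<restriction> S) a) = f (head (G \<restriction> S) a)"
      by (auto intro!: arcs dest: in_arcs_imp_in_arcs_ends)
  next
    fix v assume "v \<in> verts (G \<restriction> S)"
    then show "Digraph_Component.connected ((G \<restriction> S) \<restriction> {u \<in> verts (G \<restriction> S). f u = f v})"
      using conn[of v] by (simp only: B_eq induce_subgraph_verts)
  qed
  then have comp: "components (G \<restriction> S) = B ` S"
    by (simp only: B_eq induce_subgraph_verts)
  have PDDS: "\<exists>C. (\<forall>D. D \<in> components (G \<restriction> S) \<and> set_dist G v (verts D) \<le> ereal (real 1)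
        \<longleftrightarrow> D = C) \<and> (\<exists>!w. w \<in> verts C \<and> graph_dist G v w = set_dist G v (verts C))"
    if v: "v \<in> verts G" for v
  proof -
    obtain w where w: "w \<in> S" "w = v \<or> v \<notin> S \<and> v \<rightarrow>\<^bsub>G\<^esub> w"
      using ex1[OF v] by blast
    \<comment> \<open>Uniqueness of the component: all vertices of \<open>S\<close> within distance
      1 of \<open>v\<close> share the label of \<open>w\<close>, by \<open>arcs\<close> if
      \<open>v\<close> is in \<open>S\<close> and by \<open>ex1\<close> otherwise.\<close>
    have near: "f u = f w \<and> (v \<notin> S \<longrightarrow> u = w)" if "u \<in> S" "u = v \<or> v \<rightarrow>\<^bsub>G\<^esub> u" for u
      using that w ex1[OF v] arcs by metis
    \<comment> \<open>Uniqueness of the nearest vertex: \<open>w\<close> beats every other vertex of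
      \<open>S\<close>, by 0 < 1 if \<open>w = v\<close> and by 1 < 2 otherwise.\<close>
    have far: "graph_dist G v w < graph_dist G v u" if u: "u \<in> S" "u \<noteq> w" for u
    proof (cases "w = v")
      case True
      then show ?thesis
        using graph_dist_self[OF v] graph_dist_ge_1[of v u] u
        by (auto intro: less_le_trans[of 0 1])
    next
      case False
      then have "graph_dist G v w = 1" using w graph_dist_adj by auto
      moreover have "2 \<le> graph_dist G v u"
        using graph_dist_ge_2[of v u] near[of u] u w False by auto
      ultimately show ?thesis by (auto intro: less_le_trans[of 1 2])
    qed
    have dist: "set_dist G v (verts (B w)) = graph_dist G v w"
      unfolding set_dist_def
    proof (rule antisym)
      show "(INF u\<in>verts (B w). graph_dist G v u) \<le> graph_dist G v w"
        using w by (intro INF_lower) (auto simp: verts_B)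
      show "graph_dist G v w \<le> (INF u\<in>verts (B w). graph_dist G v u)"
        using far by (intro INF_greatest) (auto simp: verts_B intro: order.strict_implies_order)
    qed
    have le1: "graph_dist G v w \<le> 1"
      using w graph_dist_self[OF v] graph_dist_adj[of v w] by (cases "w = v") auto
    show ?thesis
    proof (intro exI[of _ "B w"] conjI allI iffI)
      fix D assume D: "D \<in> components (G \<restriction> S) \<and> set_dist G v (verts D) \<le> ereal (real 1)"
      then obtain z where z: "z \<in> S" "D = B z" by (auto simp: comp)
      from D have "set_dist G v (verts D) \<le> 1" by (simp add: one_ereal_def)
      from set_dist_le_1_imp[OF this] obtain u where "u \<in> verts D" "u = v \<or> v \<rightarrow>\<^bsub>G\<^esub> u" by auto
      then have "f z = f w" using near[of u] by (auto simp: z verts_B)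
      then show "D = B w" using z(2) B_cong[of z w] by simp
    next
      fix D assume "D = B w"
      then show "D \<in> components (G \<restriction> S)" "set_dist G v (verts D) \<le> ereal (real 1)"
        using w le1 dist by (auto simp: comp one_ereal_def)
    next
      show "\<exists>!u. u \<in> verts (B w) \<and> graph_dist G v u = set_dist G v (verts (B w))"
        unfolding dist using w far by (intro ex1I[of _ w]) (force simp: verts_B)+
    qed
  qed
  have "digraph_iso C H" if "C \<in> components (G \<restriction> S)" for C
    using that iso digraph_iso_swap[OF H(1)] unfolding comp B_def by blast
  then show ?thesis
    using S PDDS unfolding PDDS_of_def PDDS_def by blast
qed

section \<open>Paths\<close>

lemma connected_path_graph:
  assumes "k \<ge> 1"
  shows "Digraph_Component.connected (path_graph k)"
proof -
  interpret graph "path_graph k" by (rule graph_path_graph)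
  \<comment> \<open>Walks from 0 suffice: reversing one and appending another joins any two
    vertices.\<close>
  have from0: "0 \<rightarrow>\<^sup>*\<^bsub>path_graph k\<^esub> i" if "i < k" for i
    using that
  proof (induction i)
    case 0
    then show ?case by (intro reachable_refl) (simp add: path_graph_def)
  next
    case (Suc i)
    then have "i \<rightarrow>\<^bsub>path_graph k\<^esub> Suc i" by (simp add: path_graph_def)
    with Suc show ?case by (intro reachable_adj_trans[of 0 i "Suc i"]) auto
  qed
  show ?thesis
    unfolding Digraph_Component.connected_def
  proof (rule strongly_connectedI)
    show "verts (with_proj (mk_symmetric (path_graph k))) \<noteq> {}" using assms by (auto simp: path_graph_def lessThan_empty_iff)
  next
    fix u v
    assume "u \<in> verts (with_proj (mk_symmetric (path_graph k)))"
      "v \<in> verts (with_proj (mk_symmetric (path_graph k)))"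
    then have "u < k" "v < k" by (simp_all add: path_graph_def)
    then have "u \<rightarrow>\<^sup>*\<^bsub>path_graph k\<^esub> v"
      using reachable_trans[OF symmetric_reachable[OF sym_arcs from0] from0] by blast
    then show "u \<rightarrow>\<^sup>*\<^bsub>with_proj (mk_symmetric (path_graph k))\<^esub> v"
      by (rule reachable_mk_symmetricI)
  qed
qed

text \<open>Arcs are pairs of vertices, so an injective numbering \<open>p\<close> of the vertices
  already fixes the map on arcs, \<open>map_prod p p\<close>.\<close>

lemma digraph_iso_path_graph:
  assumes inj: "inj_on p {..<k}"
    and G: "verts G = p ` {..<k}" "tail G = fst" "head G = snd"
      "arcs G = {(p i, p j) | i j. i < k \<and> j < k \<and> (j = Suc i \<or> i = Suc j)}"
  shows "digraph_iso (path_graph k) G"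
proof -
  define h where "h = \<lparr>iso_verts = p, iso_arcs = map_prod p p, iso_head = snd, iso_tail = fst\<rparr>"
  interpret graph "path_graph k" by (rule graph_path_graph)
  have "inj_on (map_prod p p) ({..<k} \<times> {..<k})"
    using inj by (rule map_prod_inj_on) (rule inj)
  then have "inj_on (map_prod p p) (arcs (path_graph k))"
    by (rule inj_on_subset) (auto simp: path_graph_def)
  then have "digraph_isomorphism h"
    using inj wf_digraph_axioms unfolding digraph_isomorphism_def
    by (auto simp: h_def path_graph_def)
  moreover have "G = app_iso h (path_graph k)"
    by (rule pre_digraph.equality) (auto simp: G h_def path_graph_def image_iff)
  ultimately show ?thesis unfolding digraph_iso_def by blast
qed

section \<open>The lattice\<close>

lemma lattice_adj_iff:
  assumes x: "x \<in> lattice_points n"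
  shows "x \<rightarrow>\<^bsub>lattice_graph n\<^esub> y \<longleftrightarrow> (\<exists>i<n. \<exists>s\<in>{1, -1}. y = x(i := x i + s))"
proof
  assume "x \<rightarrow>\<^bsub>lattice_graph n\<^esub> y"
  then have y: "y \<in> lattice_points n" and "euclid_dist n x y = 1"
    by (auto simp: lattice_graph_def)
  then have "(\<Sum>i<n. (real_of_int (x i) - real_of_int (y i))\<^sup>2) = 1"
    by (simp add: euclid_dist_def L2_set_def)
  \<comment> \<open>Over the integers a sum of squares equal to 1 has a single nonzero term, and
    that term is 1.\<close>
  then have "real_of_int (\<Sum>i<n. (x i - y i)\<^sup>2) = 1" by simp
  then have sum: "(\<Sum>i<n. (x i - y i)\<^sup>2) = 1" by linarith
  then obtain i where i: "i < n" "x i \<noteq> y i"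
    by (metis (mono_tags, lifting) diff_self lessThan_iff power_zero_numeral sum.neutral zero_neq_one)
  have "(\<Sum>j<n. (x j - y j)\<^sup>2) = (x i - y i)\<^sup>2 + (\<Sum>j\<in>{..<n} - {i}. (x j - y j)\<^sup>2)"
    using i by (intro sum.remove) auto
  moreover have "(x i - y i)\<^sup>2 \<ge> 1"
    using i by (simp add: int_one_le_iff_zero_less)
  moreover have "(\<Sum>j\<in>{..<n} - {i}. (x j - y j)\<^sup>2) \<ge> 0"
    by (intro sum_nonneg) auto
  ultimately have 1: "(x i - y i)\<^sup>2 = 1" and 0: "(\<Sum>j\<in>{..<n} - {i}. (x j - y j)\<^sup>2) = 0"
    using sum by auto
  from 0 have "x j = y j" if "j < n" "j \<noteq> i" for j
    using that by (subst (asm) sum_nonneg_eq_0_iff) auto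
  \<comment> \<open>Both points are \<open>undefined\<close> outside the index range, so they can be
    compared as total functions.\<close>
  moreover have "x j = y j" if "\<not> j < n" for j
    using x y that by (auto simp: lattice_points_def PiE_def extensional_def)
  ultimately have "y j = x j" if "j \<noteq> i" for j using that by metis
  then have "y = x(i := x i + (y i - x i))" by (auto simp: fun_eq_iff)
  moreover have "y i - x i \<in> {1, -1}"
    using 1 by (auto simp: power2_eq_1_iff)
  ultimately show "\<exists>i<n. \<exists>s\<in>{1, -1}. y = x(i := x i + s)" using i by blast
next
  assume "\<exists>i<n. \<exists>s\<in>{1, -1}. y = x(i := x i + s)"
  then obtain i s where i: "i < n" and s: "s \<in> {1, -1}" and y: "y = x(i := x i + s)" by blast
  have "(\<Sum>j<n. (real_of_int (x j) - real_of_int (y j))\<^sup>2) = (\<Sum>j<n. if j = i then 1 else 0)"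
    using s by (intro sum.cong) (auto simp: y)
  also have "\<dots> = 1" using i by simp
  finally have "euclid_dist n x y = 1" by (simp add: euclid_dist_def L2_set_def)
  moreover have "y \<in> lattice_points n"
    using x i by (auto simp: y lattice_points_def PiE_def extensional_def)
  ultimately show "x \<rightarrow>\<^bsub>lattice_graph n\<^esub> y"
    using x by (simp add: lattice_graph_def)
qed

section \<open>Colours and the effect of a step on them\<close>

definition weight :: "nat \<Rightarrow> nat \<Rightarrow> (nat \<Rightarrow> int) \<Rightarrow> int" where
  "weight n k x = (\<Sum>i<n. (int i * int k + 1) * x i)"

definition modulus :: "nat \<Rightarrow> nat \<Rightarrow> int" where
  "modulus n k = (2 * int n - 1) * int k + 2"

definition colour :: "nat \<Rightarrow> nat \<Rightarrow> (nat \<Rightarrow> int) \<Rightarrow> int" where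
  "colour n k x = weight n k x mod modulus n k"

lemma weight_upd:
  assumes "i < n"
  shows "weight n k (x(i := x i + s)) = weight n k x + s * (int i * int k + 1)"
proof -
  have "weight n k (x(i := x i + s)) =
      (\<Sum>j<n. (int j * int k + 1) * x j + (if j = i then s * (int i * int k + 1) else 0))"
    unfolding weight_def by (intro sum.cong) (auto simp: algebra_simps)
  then show ?thesis using assms by (simp add: weight_def sum.distrib)
qed

lemma colour_upd:
  assumes "i < n"
  shows "colour n k (x(i := x i + s)) =
    (colour n k x + s * (int i * int k + 1)) mod modulus n k"
  by (simp add: colour_def weight_upd[OF assms] mod_simps)

lemma modulus_gt:
  assumes "n \<ge> 1"
  shows "modulus n k > int k + 1"
proof -
  have "1 * int k \<le> (2 * int n - 1) * int k" using assms by (intro mult_right_mono) auto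
  then show ?thesis by (simp add: modulus_def)
qed

lemma colour_bounds:
  assumes "n \<ge> 1"
  shows "0 \<le> colour n k x" "colour n k x < modulus n k"
  using modulus_gt[OF assms, of k] by (simp_all add: colour_def)

text \<open>In this window the remainder is \<open>z + m\<close>, \<open>z\<close> or
  \<open>z - m\<close>. Colour conditions thereby become linear inequalities.\<close>

lemma mod_less_iff:
  fixes z m k :: int
  assumes "- m \<le> z" "z < 2 * m" "0 \<le> k" "k \<le> m"
  shows "z mod m < k \<longleftrightarrow> z < k - m \<or> 0 \<le> z \<and> z < k \<or> m \<le> z \<and> z < m + k"
proof -
  consider "z < 0" | "0 \<le> z" "z < m" | "m \<le> z" by linarith
  then show ?thesis
  proof cases
    case 1
    then have "z mod m = z + m" using assms mod_pos_pos_trivial[of "z + m" m] by simp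
    with 1 assms show ?thesis by auto
  next
    case 2
    with assms show ?thesis by auto
  next
    case 3
    then have "z mod m = z - m" using assms mod_pos_pos_trivial[of "z - m" m] by simp
    with 3 assms show ?thesis by auto
  qed
qed

lemma mult_index_bounds:
  assumes "i < n"
  shows "0 \<le> int i * int k" "int i * int k + int k \<le> int n * int k"
proof -
  have "(int i + 1) * int k \<le> int n * int k" using assms by (intro mult_right_mono) auto
  then show "int i * int k + int k \<le> int n * int k" by (simp add: algebra_simps)
qed simp

text \<open>Only the unwrapped case survives: a wrapped result below \<open>k\<close> would need
  \<open>r < t + 1 + k - m\<close>, where \<open>t = i * k\<close> and \<open>m\<close> is the
  modulus, and the right-hand side is negative.\<close>

lemma minus_step_iff:
  assumes "i < n" "0 \<le> r" "r < modulus n k"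
  shows "(r + - 1 * (int i * int k + 1)) mod modulus n k < int k \<longleftrightarrow>
    int i * int k + 1 \<le> r \<and> r \<le> int i * int k + int k"
proof -
  have m: "modulus n k = 2 * (int n * int k) - int k + 2"
    by (simp add: modulus_def algebra_simps)
  define t N where "t = int i * int k" and "N = int n * int k"
  have "0 \<le> t" "t + int k \<le> N"
    using mult_index_bounds[OF assms(1), of k] by (simp_all add: t_def N_def)
  then show ?thesis
    using assms(2,3) unfolding m t_def[symmetric] N_def[symmetric]
    by (subst mod_less_iff) auto
qed

lemma plus_step_iff:
  assumes "i < n" "0 \<le> r" "r < modulus n k"
  shows "(r + (int i * int k + 1)) mod modulus n k < int k \<longleftrightarrow>
    r + int i * int k + 1 < int k \<or>
    modulus n k \<le> r + int i * int k + 1 \<and> r + int i * int k + 1 < modulus n k + int k"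
proof -
  have m: "modulus n k = 2 * (int n * int k) - int k + 2"
    by (simp add: modulus_def algebra_simps)
  define t N where "t = int i * int k" and "N = int n * int k"
  have "0 \<le> t" "t + int k \<le> N"
    using mult_index_bounds[OF assms(1), of k] by (simp_all add: t_def N_def)
  then show ?thesis
    using assms(2,3) unfolding m t_def[symmetric] N_def[symmetric]
    by (subst mod_less_iff) auto
qed

lemma multiples_close_imp_eq:
  fixes i j k :: nat
  assumes "int i * int k < int j * int k + int k" "int j * int k < int i * int k + int k"
  shows "i = j"
proof -
  have "int i * int k < (int j + 1) * int k" "int j * int k < (int i + 1) * int k"
    using assms by (simp_all add: algebra_simps)
  then show ?thesis by (auto simp: mult_less_cancel_right)
qed

text \<open>Each way of staying below colour \<open>k\<close> forces \<open>i * k < k\<close>,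
  except an upward wrap; that one is impossible because \<open>r + i * k + 1\<close> is at most
  \<open>n * k\<close>, which is less than the modulus.\<close>

lemma step_inside:
  assumes "i < n" "s \<in> {1, -1}" "0 \<le> r" "r < int k"
    and "(r + s * (int i * int k + 1)) mod modulus n k < int k"
  shows "i = 0"
proof -
  have r: "r < modulus n k" using modulus_gt[of n k] assms by simp
  have m: "modulus n k = 2 * (int n * int k) - int k + 2"
    by (simp add: modulus_def algebra_simps)
  define t N where "t = int i * int k" and "N = int n * int k"
  have "0 \<le> t" "t + int k \<le> N"
    using mult_index_bounds[OF assms(1), of k] by (simp_all add: t_def N_def)
  moreover have "t + 1 \<le> r \<and> r \<le> t + int k \<or> r + t + 1 < int k \<or> modulus n k \<le> r + t + 1"
    using assms(2,5) minus_step_iff[OF assms(1,3) r] plus_step_iff[OF assms(1,3) r]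
    by (auto simp: t_def)
  ultimately have "t < int k"
    using assms(3,4) m unfolding N_def[symmetric] by linarith
  then have "int i * int k < int k" by (simp add: t_def)
  then show ?thesis using multiples_close_imp_eq[of i k 0] assms by simp
qed

text \<open>Write \<open>m\<close> for the modulus. The colours served by downward steps form
  \<open>n\<close> consecutive blocks of length \<open>k\<close> tiling \<open>[1, n * k]\<close>;
  those served by upward steps tile \<open>[n * k + 1, m + k - 2]\<close>. Every \<open>r\<close>
  from \<open>k\<close> to \<open>m - 1\<close> lies in exactly one block.\<close>

lemma ex1_step_outside:
  assumes "k \<ge> 1" "int k \<le> r" "r < modulus n k"
  shows "\<exists>!(i, s). i < n \<and> s \<in> {1, -1} \<and>
    (r + s * (int i * int k + 1)) mod modulus n k < int k"
proof -
  have m: "modulus n k = 2 * (int n * int k) - int k + 2"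
    by (simp add: modulus_def algebra_simps)
  have r0: "0 \<le> r" using assms by simp
  define Q where "Q = (\<lambda>(i, s). i < n \<and> s \<in> {1, -1} \<and>
    (r + s * (int i * int k + 1)) mod modulus n k < int k)"
  have Q: "Q (i, s) \<longleftrightarrow> i < n \<and>
      (s = -1 \<and> int i * int k + 1 \<le> r \<and> r \<le> int i * int k + int k \<or>
       s = 1 \<and> modulus n k \<le> r + int i * int k + 1 \<and> r + int i * int k + 1 < modulus n k + int k)"
    for i s
  proof -
    have "\<not> r + int i * int k + 1 < int k"
      using assms(2) by (simp add: not_less add_increasing2)
    then show ?thesis
      using minus_step_iff[of i n r k] plus_step_iff[of i n r k] r0 assms(3)
      unfolding Q_def by auto
  qed
  have "\<exists>a. Q a"
  proof (cases "r \<le> int n * int k")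
    case True
    \<comment> \<open>The number of the downward block \<open>[i * k + 1, i * k + k]\<close> that
      contains \<open>r\<close>.\<close>
    define i where "i = nat ((r - 1) div int k)"
    have i: "int i = (r - 1) div int k" using assms by (simp add: i_def pos_imp_zdiv_nonneg_iff)
    have "int i * int k + (r - 1) mod int k = r - 1" unfolding i by simp
    moreover have "0 \<le> (r - 1) mod int k" "(r - 1) mod int k < int k" using assms by auto
    ultimately have *: "int i * int k + 1 \<le> r" "r \<le> int i * int k + int k" by auto
    then have "int i * int k < int n * int k" using True by linarith
    then have "i < n" by (auto simp: mult_less_cancel_right)
    with * have "Q (i, -1)" by (simp add: Q)
    then show ?thesis ..
  next
    case False
    \<comment> \<open>Measuring from the upper end \<open>m + k - 2\<close> reflects the upward
      blocks onto \<open>[i * k, i * k + k)\<close>, so division by \<open>k\<close> again finds the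
      axis.\<close>
    define u where "u = modulus n k + int k - 2 - r"
    have u: "0 \<le> u" "u < int n * int k" using False assms m unfolding u_def by linarith+
    define i where "i = nat (u div int k)"
    have i: "int i = u div int k" using u assms by (simp add: i_def pos_imp_zdiv_nonneg_iff)
    have "int i * int k + u mod int k = u" unfolding i by simp
    moreover have "0 \<le> u mod int k" "u mod int k < int k" using assms by auto
    ultimately have *: "int i * int k \<le> u" "u < int i * int k + int k" by auto
    then have "int i * int k < int n * int k" using u by linarith
    then have "i < n" by (auto simp: mult_less_cancel_right)
    with * have "Q (i, 1)" by (simp add: Q u_def)
    then show ?thesis ..
  qed
  moreover have "a = b" if "Q a" "Q b" for a b
  proof -
    obtain i s j t where [simp]: "a = (i, s)" "b = (j, t)" by fastforce
    have ij: "i < n" "j < n" using that Q by auto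
    note bounds = mult_index_bounds[OF ij(1), of k] mult_index_bounds[OF ij(2), of k]
    define x y N where "x = int i * int k" and "y = int j * int k" and "N = int n * int k"
    have "0 \<le> x" "x + int k \<le> N" "0 \<le> y" "y + int k \<le> N" "modulus n k = 2 * N - int k + 2"
      using bounds m by (simp_all add: x_def y_def N_def)
    moreover have
      "s = -1 \<and> x + 1 \<le> r \<and> r \<le> x + int k \<or>
       s = 1 \<and> modulus n k \<le> r + x + 1 \<and> r + x + 1 < modulus n k + int k"
      "t = -1 \<and> y + 1 \<le> r \<and> r \<le> y + int k \<or>
       t = 1 \<and> modulus n k \<le> r + y + 1 \<and> r + y + 1 < modulus n k + int k"
      using that by (simp_all add: Q x_def y_def)
    \<comment> \<open>Opposite signs would give both \<open>r \<le> N\<close> and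
      \<open>r \<ge> N + 1\<close>; with equal signs the two blocks share \<open>r\<close>, so their
      offsets differ by less than \<open>k\<close>.\<close>
    ultimately have "s = t" "x < y + int k" "y < x + int k" by linarith+
    then show ?thesis using multiples_close_imp_eq[of i k j] by (simp add: x_def y_def)
  qed
  ultimately have "\<exists>!a. Q a" by blast
  then show ?thesis unfolding Q_def .
qed

section \<open>The components and neighbours of the dominating set\<close>

definition path_verts :: "nat \<Rightarrow> nat \<Rightarrow> (nat \<Rightarrow> int) set" where
  "path_verts n k = {x \<in> lattice_points n. colour n k x < int k}"

text \<open>For a point of \<open>path_verts\<close> this is the end of colour 0 of its path, and it
  serves as the label of its component.\<close>

definition start :: "nat \<Rightarrow> nat \<Rightarrow> (nat \<Rightarrow> int) \<Rightarrow> nat \<Rightarrow> int" where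
  "start n k x = x(0 := x 0 - colour n k x)"

text \<open>The step is along axis 0 and does not wrap around, so coordinate 0 and the colour change
  by the same amount.\<close>

lemma adj_path_verts_imp_start_eq:
  assumes "n \<ge> 1" "x \<in> path_verts n k" "y \<in> path_verts n k" "x \<rightarrow>\<^bsub>lattice_graph n\<^esub> y"
  shows "start n k x = start n k y"
proof -
  have x: "x \<in> lattice_points n" "colour n k x < int k" and y: "colour n k y < int k"
    using assms by (auto simp: path_verts_def)
  obtain i s where i: "i < n" and s: "s \<in> {1, -1}" and y_eq: "y = x(i := x i + s)"
    using assms(4) lattice_adj_iff[OF x(1)] by blast
  note c0 = colour_bounds(1)[OF assms(1), of k x]
  have cy: "colour n k y = (colour n k x + s * (int i * int k + 1)) mod modulus n k"
    unfolding y_eq by (rule colour_upd[OF i])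
  then have "i = 0" using step_inside[OF i s c0 x(2)] y by simp
  with cy have cy: "colour n k y = (colour n k x + s) mod modulus n k" by simp
  note m = modulus_gt[OF assms(1), of k]
  \<comment> \<open>Stepping below 0 would give the colour \<open>modulus n k - 1\<close>, which is
    at least \<open>k\<close>.\<close>
  have "0 \<le> colour n k x + s"
  proof (rule ccontr)
    assume "\<not> ?thesis"
    with s c0 have "colour n k x + s = -1" by auto
    then have "colour n k y = modulus n k - 1"
      using m cy by (simp add: zmod_minus1)
    with m y show False by simp
  qed
  moreover have "colour n k x + s < modulus n k" using s x(2) m by auto
  ultimately have "colour n k y = colour n k x + s" using cy by simp
  then show ?thesis unfolding start_def y_eq \<open>i = 0\<close> by simp
qed

lemma digraph_iso_start_class:
  assumes n: "n \<ge> 1" and v: "v \<in> path_verts n k"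
  shows "digraph_iso (path_graph k)
    (lattice_graph n \<restriction> {u \<in> path_verts n k. start n k u = start n k v})"
proof -
  define b where "b = start n k v"
  \<comment> \<open>The colour-0 end moved \<open>j\<close> steps along axis 0; its colour is
    \<open>j\<close> for \<open>j < k\<close>, so the colour recovers the position on the
    path.\<close>
  define p where "p j = b(0 := b 0 + int j)" for j
  have v': "v \<in> lattice_points n" using v by (simp add: path_verts_def)
  have lat: "p j \<in> lattice_points n" for j
    using v' n by (auto simp: p_def b_def start_def lattice_points_def PiE_def extensional_def)
  have col: "colour n k (p j) = int j" if "j < k" for j
  proof -
    have "p j = v(0 := v 0 + (int j - colour n k v))"
      by (simp add: p_def b_def start_def fun_eq_iff)
    then show ?thesis
      using n that modulus_gt[OF n, of k] by (simp add: colour_upd)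
  qed
  have class_eq: "{u \<in> path_verts n k. start n k u = start n k v} = p ` {..<k}"
  proof (intro equalityI subsetI)
    fix u assume u: "u \<in> {u \<in> path_verts n k. start n k u = start n k v}"
    then have "b = u(0 := u 0 - colour n k u)" by (simp add: b_def start_def)
    then have "u = p (nat (colour n k u))"
      using colour_bounds(1)[OF n, of k u] by (simp add: p_def)
    moreover have "nat (colour n k u) < k"
      using u colour_bounds(1)[OF n, of k u] by (auto simp: path_verts_def)
    ultimately show "u \<in> p ` {..<k}" by auto
  next
    fix u assume "u \<in> p ` {..<k}"
    then obtain j where j: "j < k" "u = p j" by auto
    have "start n k (p j) = b" using j by (simp add: start_def col) (simp add: p_def)
    then show "u \<in> {u \<in> path_verts n k. start n k u = start n k v}"
      using j lat col by (auto simp: path_verts_def b_def)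
  qed
  have adj: "p i \<rightarrow>\<^bsub>lattice_graph n\<^esub> p j \<longleftrightarrow> j = Suc i \<or> i = Suc j" for i j
  proof
    assume "p i \<rightarrow>\<^bsub>lattice_graph n\<^esub> p j"
    then obtain l s where s: "s \<in> {1, -1}" and eq: "p j = (p i)(l := p i l + s)"
      unfolding lattice_adj_iff[OF lat] by blast
    \<comment> \<open>All points \<open>p j\<close> agree off axis 0, whereas the step changes
      coordinate \<open>l\<close>.\<close>
    have "l = 0"
      using fun_cong[OF eq, of l] s by (auto simp: p_def split: if_splits)
    then have "int j = int i + s" using fun_cong[OF eq, of 0] by (simp add: p_def)
    then show "j = Suc i \<or> i = Suc j" using s by auto
  next
    assume *: "j = Suc i \<or> i = Suc j"
    have "p j = (p i)(0 := p i 0 + (int j - int i))" by (simp add: p_def)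
    moreover have "int j - int i \<in> {1, -1}" using * by auto
    ultimately show "p i \<rightarrow>\<^bsub>lattice_graph n\<^esub> p j"
      unfolding lattice_adj_iff[OF lat] using n by (metis less_le_trans zero_less_one)
  qed
  have "inj_on p {..<k}"
    by (rule inj_onI) (use col in \<open>metis lessThan_iff of_nat_eq_iff\<close>)
  then show ?thesis
    unfolding class_eq
  proof (rule digraph_iso_path_graph)
    show "arcs (lattice_graph n \<restriction> p ` {..<k}) =
        {(p i, p j) |i j. i < k \<and> j < k \<and> (j = Suc i \<or> i = Suc j)}"
      using adj by (auto simp: lattice_graph_def; blast)
  qed (auto simp: lattice_graph_def)
qed

text \<open>The colour of a neighbour depends only on the colour of \<open>v\<close> and the step
  taken, so the unique good pair of axis and sign yields the unique neighbour.\<close>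

lemma ex1_adj_path_verts:
  assumes n: "n \<ge> 1" and k: "k \<ge> 1" and v: "v \<in> lattice_points n" "v \<notin> path_verts n k"
  shows "\<exists>!w. w \<in> path_verts n k \<and> v \<rightarrow>\<^bsub>lattice_graph n\<^esub> w"
proof -
  have c: "int k \<le> colour n k v" "colour n k v < modulus n k"
    using v colour_bounds[OF n, of k v] by (auto simp: path_verts_def)
  let ?Q = "\<lambda>i s. i < n \<and> s \<in> {1, -1} \<and>
    (colour n k v + s * (int i * int k + 1)) mod modulus n k < int k"
  have iff: "w \<in> path_verts n k \<and> v \<rightarrow>\<^bsub>lattice_graph n\<^esub> w \<longleftrightarrow>
      (\<exists>i s. ?Q i s \<and> w = v(i := v i + s))" for w
  proof -
    have "w \<in> path_verts n k \<longleftrightarrow> colour n k w < int k" if "v \<rightarrow>\<^bsub>lattice_graph n\<^esub> w"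
      using that by (simp add: lattice_graph_def path_verts_def)
    then show ?thesis
      using lattice_adj_iff[OF v(1), of w] by (metis colour_upd)
  qed
  obtain i s where Q: "?Q i s" and uniq: "\<And>j t. ?Q j t \<Longrightarrow> j = i \<and> t = s"
    using ex1_step_outside[OF k c] by (auto simp: Ex1_def split: prod.splits)
  show ?thesis
    unfolding iff
  proof (rule ex1I)
    show "\<exists>i' s'. ?Q i' s' \<and> v(i := v i + s) = v(i' := v i' + s')" using Q by blast
  next
    fix w assume "\<exists>j t. ?Q j t \<and> w = v(j := v j + t)"
    then show "w = v(i := v i + s)" using uniq by blast
  qed
qed

theorem theorem7:
  fixes n k :: nat
  assumes "n \<ge> 2" and "k \<ge> 1"
  shows "\<exists>S. PDDS_of (lattice_graph n) 1 (path_graph k) S"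
proof -
  have n: "n \<ge> 1" using assms by simp
  interpret G: sym_digraph "lattice_graph n" by (rule sym_digraph_lattice_graph)
  interpret P: graph "path_graph k" by (rule graph_path_graph)
  have verts: "verts (lattice_graph n) = lattice_points n" by (simp add: lattice_graph_def)
  have "PDDS_of (lattice_graph n) 1 (path_graph k) (path_verts n k)"
  proof (rule G.PDDS_of_1_if_label_classes[where f = "start n k"])
    show "path_verts n k \<subseteq> verts (lattice_graph n)" by (auto simp: verts path_verts_def)
    show "wf_digraph (path_graph k)" ..
    show "Digraph_Component.connected (path_graph k)" using assms(2) by (rule connected_path_graph)
  qed (use adj_path_verts_imp_start_eq[OF n] digraph_iso_start_class[OF n]
      ex1_adj_path_verts[OF n assms(2)] in \<open>simp_all add: verts\<close>)
  then show ?thesis ..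
qed

end
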